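(* Let $R$ be an associative ring with identity and let $M_1$ and $M_2$ be Rickart (unital right) $R$-modules. Suppose that: (1) every submodule $N$ of $M_1\oplus M_2$ is of the form $N=N_1\oplus N_2$ with $N_i$ a submodule of $M_i$ for $i=1,2$; (2) for all $i,j\in\{1,2\}$, the module $M_i$ is $M_j$-Rickart. Then $M=M_1\oplus M_2$ is a Rickart module.
   Context: A right $R$-module $M$ with endomorphism ring $S=\operatorname{End}_R(M)$ (acting on the left of $M$) is called a Rickart module if for every $\varphi\in S$ there is an idempotent $e=e^2\in S$ with $\operatorname{Ker}(\varphi)=eM$; equivalently, the kernel of every endomorphism of $M$ is a direct summand of $M$. For right $R$-modules $M$ and $N$, $M$ is called $N$-Rickart (or relatively Rickart to $N$) if for every $R$-homomorphism $\varphi\colon M\to N$, $\operatorname{Ker}(\varphi)$ is a direct summand of $M$. *)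

theory Defs
  imports "HOL-Algebra.Algebra"
begin

text \<open>
  The locale \<open>module\<close> of HOL-Algebra is restricted to commutative rings, so right modules over
  an arbitrary ring with identity are introduced here. They reuse the record type \<open>module\<close>:
  for a right module, \<open>a \<odot>\<^bsub>M\<^esub> x\<close> is to be read as the element \<open>x a\<close>, whence
  the order of the factors in \<open>smult_assoc\<close>: \<open>x (a b) = (x a) b\<close>.
  The multiplicative fields of the record \<open>M\<close> play no role.
\<close>

locale right_module = R?: ring R + M?: abelian_group M
  for R :: "('a, 'r) ring_scheme" (structure) and M :: "('a, 'b, 'm) module_scheme" (structure) +
  assumes smult_closed [simp, intro]:
      "\<lbrakk>a \<in> carrier R; x \<in> carrier M\<rbrakk> \<Longrightarrow> a \<odot>\<^bsub>M\<^esub> x \<in> carrier M"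
    and smult_l_distr:
      "\<lbrakk>a \<in> carrier R; b \<in> carrier R; x \<in> carrier M\<rbrakk> \<Longrightarrow>
        (a \<oplus> b) \<odot>\<^bsub>M\<^esub> x = a \<odot>\<^bsub>M\<^esub> x \<oplus>\<^bsub>M\<^esub> b \<odot>\<^bsub>M\<^esub> x"
    and smult_r_distr:
      "\<lbrakk>a \<in> carrier R; x \<in> carrier M; y \<in> carrier M\<rbrakk> \<Longrightarrow>
        a \<odot>\<^bsub>M\<^esub> (x \<oplus>\<^bsub>M\<^esub> y) = a \<odot>\<^bsub>M\<^esub> x \<oplus>\<^bsub>M\<^esub> a \<odot>\<^bsub>M\<^esub> y"
    and smult_assoc:
      "\<lbrakk>a \<in> carrier R; b \<in> carrier R; x \<in> carrier M\<rbrakk> \<Longrightarrow>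
        (a \<otimes> b) \<odot>\<^bsub>M\<^esub> x = b \<odot>\<^bsub>M\<^esub> (a \<odot>\<^bsub>M\<^esub> x)"
    and smult_one [simp]:
      "x \<in> carrier M \<Longrightarrow> \<one> \<odot>\<^bsub>M\<^esub> x = x"

text \<open>
  Homomorphisms are extensional functions (equal to \<open>undefined\<close> off \<open>carrier M\<close>), so that
  HOL equality of homomorphisms is equality of maps on \<open>carrier M\<close>.
\<close>

definition mod_hom ::
  "('a, 'r) ring_scheme \<Rightarrow> ('a, 'b, 'm) module_scheme \<Rightarrow> ('a, 'c, 'n) module_scheme \<Rightarrow> ('b \<Rightarrow> 'c) set"
  where "mod_hom R M N =
    {f \<in> carrier M \<rightarrow>\<^sub>E carrier N.
      (\<forall>x\<in>carrier M. \<forall>y\<in>carrier M. f (x \<oplus>\<^bsub>M\<^esub> y) = f x \<oplus>\<^bsub>N\<^esub> f y) \<and>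
      (\<forall>a\<in>carrier R. \<forall>x\<in>carrier M. f (a \<odot>\<^bsub>M\<^esub> x) = a \<odot>\<^bsub>N\<^esub> f x)}"

definition mod_End :: "('a, 'r) ring_scheme \<Rightarrow> ('a, 'b, 'm) module_scheme \<Rightarrow> ('b \<Rightarrow> 'b) ring"
  where "mod_End R M =
    \<lparr>carrier = mod_hom R M M,
     monoid.mult = compose (carrier M),
     one = (\<lambda>x\<in>carrier M. x),
     ring.zero = (\<lambda>x\<in>carrier M. \<zero>\<^bsub>M\<^esub>),
     ring.add = (\<lambda>f g. \<lambda>x\<in>carrier M. f x \<oplus>\<^bsub>M\<^esub> g x)\<rparr>"

definition direct_summand ::
  "('a, 'r) ring_scheme \<Rightarrow> ('a, 'b, 'm) module_scheme \<Rightarrow> 'b set \<Rightarrow> bool"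
  where "direct_summand R M K \<longleftrightarrow>
    submodule K R M \<and>
    (\<exists>L. submodule L R M \<and> K <+>\<^bsub>M\<^esub> L = carrier M \<and> K \<inter> L = {\<zero>\<^bsub>M\<^esub>})"

locale rickart_module = right_module +
  assumes rickart:
    "\<phi> \<in> carrier (mod_End R M) \<Longrightarrow>
      \<exists>e\<in>carrier (mod_End R M). e \<otimes>\<^bsub>mod_End R M\<^esub> e = e \<and> a_kernel M M \<phi> = e ` carrier M"

text \<open>\<open>relatively_rickart R M N\<close> means that \<open>M\<close> is \<open>N\<close>-Rickart.\<close>

definition relatively_rickart ::
  "('a, 'r) ring_scheme \<Rightarrow> ('a, 'b, 'm) module_scheme \<Rightarrow> ('a, 'c, 'n) module_scheme \<Rightarrow> bool"
  where "relatively_rickart R M N \<longleftrightarrow>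
    (\<forall>\<phi>\<in>mod_hom R M N. direct_summand R M (a_kernel M N \<phi>))"

definition mod_dsum ::
  "('a, 'b, 'm) module_scheme \<Rightarrow> ('a, 'c, 'n) module_scheme \<Rightarrow> ('a, 'b \<times> 'c) module"
  where "mod_dsum M N =
    ring.extend (RDirProd M N) (module.fields (\<lambda>a (x, y). (a \<odot>\<^bsub>M\<^esub> x, a \<odot>\<^bsub>N\<^esub> y)))"

lemma mod_dsum_simps [simp]:
  "carrier (mod_dsum M N) = carrier M \<times> carrier N"
  "(x, y) \<oplus>\<^bsub>mod_dsum M N\<^esub> (x', y') = (x \<oplus>\<^bsub>M\<^esub> x', y \<oplus>\<^bsub>N\<^esub> y')"
  "\<zero>\<^bsub>mod_dsum M N\<^esub> = (\<zero>\<^bsub>M\<^esub>, \<zero>\<^bsub>N\<^esub>)"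
  "a \<odot>\<^bsub>mod_dsum M N\<^esub> (x, y) = (a \<odot>\<^bsub>M\<^esub> x, a \<odot>\<^bsub>N\<^esub> y)"
  by (simp_all add: mod_dsum_def RDirProd_def DirProd_def monoid.defs ring.defs module.defs)

lemma mod_End_simps [simp]:
  "carrier (mod_End R M) = mod_hom R M M"
  "f \<otimes>\<^bsub>mod_End R M\<^esub> g = compose (carrier M) f g"
  "\<one>\<^bsub>mod_End R M\<^esub> = (\<lambda>x\<in>carrier M. x)"
  "\<zero>\<^bsub>mod_End R M\<^esub> = (\<lambda>x\<in>carrier M. \<zero>\<^bsub>M\<^esub>)"
  "f \<oplus>\<^bsub>mod_End R M\<^esub> g = (\<lambda>x\<in>carrier M. f x \<oplus>\<^bsub>M\<^esub> g x)"
  by (simp_all add: mod_End_def)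

lemma right_module_mod_dsum:
  assumes "right_module R M" and "right_module R N"
  shows "right_module R (mod_dsum M N)"
proof -
  interpret M: right_module R M by fact
  interpret N: right_module R N by fact
  have "abelian_group (mod_dsum M N)"
  proof (rule abelian_groupI)
    fix z assume "z \<in> carrier (mod_dsum M N)"
    then obtain x y where "z = (x, y)" "x \<in> carrier M" "y \<in> carrier N" by auto
    then show "\<exists>w\<in>carrier (mod_dsum M N). w \<oplus>\<^bsub>mod_dsum M N\<^esub> z = \<zero>\<^bsub>mod_dsum M N\<^esub>"
      by (intro bexI[of _ "(\<ominus>\<^bsub>M\<^esub> x, \<ominus>\<^bsub>N\<^esub> y)"]) (auto simp: M.M.l_neg N.M.l_neg)
  qed (auto simp: M.M.add.m_ac N.M.add.m_ac)
  then show ?thesis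
    by (intro right_module.intro right_module_axioms.intro M.R.ring_axioms)
      (auto simp: M.smult_l_distr N.smult_l_distr M.smult_r_distr N.smult_r_distr
        M.smult_assoc N.smult_assoc)
qed

lemma (in right_module) ring_mod_End: "ring (mod_End R M)"
proof (rule ringI)
  have smult_zero: "a \<odot>\<^bsub>M\<^esub> \<zero>\<^bsub>M\<^esub> = \<zero>\<^bsub>M\<^esub>" if "a \<in> carrier R" for a
    using smult_r_distr[of a "\<zero>\<^bsub>M\<^esub>" "\<zero>\<^bsub>M\<^esub>"] that
    by (metis M.add.r_cancel_one' M.l_zero M.zero_closed smult_closed)
  have smult_minus: "a \<odot>\<^bsub>M\<^esub> (\<ominus>\<^bsub>M\<^esub> x) = \<ominus>\<^bsub>M\<^esub> (a \<odot>\<^bsub>M\<^esub> x)"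
    if "a \<in> carrier R" "x \<in> carrier M" for a x
    using smult_r_distr[of a "\<ominus>\<^bsub>M\<^esub> x" x] that smult_zero
    by (metis M.add.inv_closed M.l_neg M.minus_equality smult_closed)
  show "abelian_group (mod_End R M)"
  proof (rule abelian_groupI)
    fix f assume f: "f \<in> carrier (mod_End R M)"
    let ?g = "\<lambda>x\<in>carrier M. \<ominus>\<^bsub>M\<^esub> f x"
    have "?g \<in> carrier (mod_End R M)"
      using f by (auto simp: mod_hom_def PiE_iff smult_minus M.minus_add)
    moreover have "?g \<oplus>\<^bsub>mod_End R M\<^esub> f = \<zero>\<^bsub>mod_End R M\<^esub>"
      using f by (auto simp: mod_hom_def PiE_iff M.l_neg intro!: restrict_ext)
    ultimately show "\<exists>g\<in>carrier (mod_End R M). g \<oplus>\<^bsub>mod_End R M\<^esub> f = \<zero>\<^bsub>mod_End R M\<^esub>"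
      by blast
  next
    fix f assume "f \<in> carrier (mod_End R M)"
    then show "\<zero>\<^bsub>mod_End R M\<^esub> \<oplus>\<^bsub>mod_End R M\<^esub> f = f"
      by (auto simp: mod_hom_def PiE_iff extensional_def fun_eq_iff)
  qed (auto simp: mod_hom_def PiE_iff M.add.m_ac smult_r_distr smult_zero intro!: restrict_ext)
  show "Group.monoid (mod_End R M)"
    by (rule monoidI)
      (auto simp: mod_hom_def PiE_iff compose_def extensional_def fun_eq_iff)
qed (auto simp: mod_hom_def PiE_iff compose_def fun_eq_iff)

end

theory Submission
  imports Defs
begin

text \<open>
  The kernel of an endomorphism \<open>\<phi>\<close> of \<open>M\<^sub>1 \<oplus> M\<^sub>2\<close> is a submodule, hence of the form
  \<open>K\<^sub>1 \<oplus> K\<^sub>2\<close>, where \<open>K\<^sub>i\<close> is the intersection of the kernels of the two components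
  \<open>M\<^sub>i \<rightarrow> M\<^sub>1\<close> and \<open>M\<^sub>i \<rightarrow> M\<^sub>2\<close> of \<open>\<phi>\<close>. To write \<open>Ker f \<inter> Ker g\<close> as the image of an
  idempotent, where \<open>f\<close> is an endomorphism, take an idempotent \<open>e\<close> with image
  \<open>Ker f\<close> and an idempotent \<open>p\<close> with image \<open>Ker (g e) = (Ker f \<inter> Ker g) \<oplus> Ker e\<close>;
  then \<open>e p\<close> is an idempotent with image \<open>Ker f \<inter> Ker g\<close>.
\<close>

lemma a_kernel_iff: "x \<in> a_kernel M N f \<longleftrightarrow> x \<in> carrier M \<and> f x = \<zero>\<^bsub>N\<^esub>"
  by (simp add: a_kernel_def kernel_def)

lemma mod_homI:
  assumes "f \<in> extensional (carrier M)"
    and "\<And>x. x \<in> carrier M \<Longrightarrow> f x \<in> carrier N"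
    and "\<And>x y. \<lbrakk>x \<in> carrier M; y \<in> carrier M\<rbrakk> \<Longrightarrow> f (x \<oplus>\<^bsub>M\<^esub> y) = f x \<oplus>\<^bsub>N\<^esub> f y"
    and "\<And>a x. \<lbrakk>a \<in> carrier R; x \<in> carrier M\<rbrakk> \<Longrightarrow> f (a \<odot>\<^bsub>M\<^esub> x) = a \<odot>\<^bsub>N\<^esub> f x"
  shows "f \<in> mod_hom R M N"
  using assms by (auto simp: mod_hom_def PiE_iff)

lemma mod_homD:
  assumes "f \<in> mod_hom R M N"
  shows mod_hom_extensional: "f \<in> extensional (carrier M)"
    and mod_hom_closed: "x \<in> carrier M \<Longrightarrow> f x \<in> carrier N"
    and mod_hom_add: "\<lbrakk>x \<in> carrier M; y \<in> carrier M\<rbrakk> \<Longrightarrow> f (x \<oplus>\<^bsub>M\<^esub> y) = f x \<oplus>\<^bsub>N\<^esub> f y"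
    and mod_hom_smult: "\<lbrakk>a \<in> carrier R; x \<in> carrier M\<rbrakk> \<Longrightarrow> f (a \<odot>\<^bsub>M\<^esub> x) = a \<odot>\<^bsub>N\<^esub> f x"
  using assms by (auto simp: mod_hom_def PiE_iff)

lemma (in right_module) smult_r_zero [simp]:
  "a \<in> carrier R \<Longrightarrow> a \<odot>\<^bsub>M\<^esub> \<zero>\<^bsub>M\<^esub> = \<zero>\<^bsub>M\<^esub>"
  using smult_r_distr[of a "\<zero>\<^bsub>M\<^esub>" "\<zero>\<^bsub>M\<^esub>"]
  by (metis M.add.r_cancel_one' M.l_zero M.zero_closed smult_closed)

lemma mod_hom_compose:
  assumes "right_module R L" and "f \<in> mod_hom R L M" and "g \<in> mod_hom R M N"
  shows "compose (carrier L) g f \<in> mod_hom R L N"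
proof -
  interpret L: right_module R L by fact
  show ?thesis
    by (rule mod_homI)
      (auto simp: compose_def mod_homD[OF assms(2)] mod_homD[OF assms(3)])
qed

lemma mod_hom_zero:
  assumes "right_module R M" and "right_module R N" and "f \<in> mod_hom R M N"
  shows "f \<zero>\<^bsub>M\<^esub> = \<zero>\<^bsub>N\<^esub>"
proof -
  interpret M: right_module R M by fact
  interpret N: right_module R N by fact
  show ?thesis
    using mod_hom_add[OF assms(3), of "\<zero>\<^bsub>M\<^esub>" "\<zero>\<^bsub>M\<^esub>"] mod_hom_closed[OF assms(3), of "\<zero>\<^bsub>M\<^esub>"]
    by (metis M.M.l_zero M.M.zero_closed N.M.add.r_cancel_one')
qed

lemma mod_hom_minus:
  assumes "right_module R M" and "right_module R N" and "f \<in> mod_hom R M N"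
    and "x \<in> carrier M"
  shows "f (\<ominus>\<^bsub>M\<^esub> x) = \<ominus>\<^bsub>N\<^esub> f x"
proof -
  interpret M: right_module R M by fact
  interpret N: right_module R N by fact
  have "f (\<ominus>\<^bsub>M\<^esub> x) \<oplus>\<^bsub>N\<^esub> f x = \<zero>\<^bsub>N\<^esub>"
    using mod_hom_add[OF assms(3), of "\<ominus>\<^bsub>M\<^esub> x" x] mod_hom_zero[OF assms(1-3)] assms(4)
    by (simp add: M.M.l_neg)
  then show ?thesis
    using mod_hom_closed[OF assms(3)] assms(4) by (metis M.M.a_inv_closed N.M.minus_equality)
qed

lemma submodule_a_kernel:
  assumes "right_module R M" and "right_module R N" and "f \<in> mod_hom R M N"
  shows "submodule (a_kernel M N f) R M"
proof -
  interpret M: right_module R M by fact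
  interpret N: right_module R N by fact
  note [simp] = mod_hom_zero[OF assms] mod_hom_minus[OF assms] mod_homD[OF assms(3)]
  show ?thesis
    by (intro submodule.intro subgroup.intro submodule_axioms.intro)
      (auto simp: a_kernel_iff simp flip: a_inv_def)
qed

text \<open>The idempotent is the projection onto \<open>K\<close> along a complement
  \<open>L\<close>. This links the two notions in play: relative Rickartness speaks of direct
  summands, while \<open>rickart_module\<close> asks for images of idempotents.\<close>

lemma (in right_module) direct_summand_idempotent:
  assumes "direct_summand R M K"
  shows "\<exists>e\<in>mod_hom R M M. compose (carrier M) e e = e \<and> e ` carrier M = K"
proof -
  obtain L where K: "submodule K R M" and L: "submodule L R M"
    and sum: "K <+>\<^bsub>M\<^esub> L = carrier M" and int: "K \<inter> L = {\<zero>\<^bsub>M\<^esub>}"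
    using assms by (auto simp: direct_summand_def)
  interpret K: subgroup K "add_monoid M" using K by (rule submodule.axioms)
  interpret L: subgroup L "add_monoid M" using L by (rule submodule.axioms)
  note smultK = submodule.smult_closed[OF K] and smultL = submodule.smult_closed[OF L]
  have Kc: "k \<in> carrier M" if "k \<in> K" for k using K.mem_carrier[OF that] by simp
  have Lc: "l \<in> carrier M" if "l \<in> L" for l using L.mem_carrier[OF that] by simp
  have addK: "k \<oplus>\<^bsub>M\<^esub> k' \<in> K" if "k \<in> K" "k' \<in> K" for k k' using K.m_closed that by simp
  have addL: "k \<oplus>\<^bsub>M\<^esub> k' \<in> L" if "k \<in> L" "k' \<in> L" for k k' using L.m_closed that by simp
  have negK: "\<ominus>\<^bsub>M\<^esub> k \<in> K" if "k \<in> K" for k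
    using K.m_inv_closed that by (simp add: a_inv_def)
  have negL: "\<ominus>\<^bsub>M\<^esub> k \<in> L" if "k \<in> L" for k
    using L.m_inv_closed that by (simp add: a_inv_def)
  \<comment> \<open>Moving terms across the equation gives k - k' = l' - l, an element of both
    \<open>K\<close> and \<open>L\<close>, hence zero.\<close>
  have unique: "k = k'"
    if "k \<in> K" "k' \<in> K" "l \<in> L" "l' \<in> L" "k \<oplus>\<^bsub>M\<^esub> l = k' \<oplus>\<^bsub>M\<^esub> l'" for k k' l l'
  proof -
    have c: "k \<in> carrier M" "k' \<in> carrier M" "l \<in> carrier M" "l' \<in> carrier M"
      using that Kc Lc by auto
    have "l' = \<ominus>\<^bsub>M\<^esub> k' \<oplus>\<^bsub>M\<^esub> (k \<oplus>\<^bsub>M\<^esub> l)"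
      using c by (simp add: that(5) M.r_neg1)
    also have "\<dots> = (k \<ominus>\<^bsub>M\<^esub> k') \<oplus>\<^bsub>M\<^esub> l"
      using c by (simp add: M.minus_eq M.a_ac)
    finally have "k \<ominus>\<^bsub>M\<^esub> k' = l' \<ominus>\<^bsub>M\<^esub> l"
      using c by (simp add: M.minus_eq M.a_assoc M.r_neg)
    then have "k \<ominus>\<^bsub>M\<^esub> k' \<in> K \<inter> L"
      using that addK addL negK negL by (metis IntI M.minus_eq)
    then have "k \<oplus>\<^bsub>M\<^esub> \<ominus>\<^bsub>M\<^esub> k' = \<zero>\<^bsub>M\<^esub>" using int by (simp add: M.minus_eq)
    then show ?thesis using M.minus_equality[of k "\<ominus>\<^bsub>M\<^esub> k'"] c by simp
  qed
  \<comment> \<open>The projection along \<open>L\<close>. The description is well defined because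
    every element decomposes (\<open>decomp\<close>) with a unique component in \<open>K\<close>
    (\<open>unique\<close>).\<close>
  define e where "e = (\<lambda>x\<in>carrier M. THE k. k \<in> K \<and> (\<exists>l\<in>L. x = k \<oplus>\<^bsub>M\<^esub> l))"
  have e_sum: "e (k \<oplus>\<^bsub>M\<^esub> l) = k" if "k \<in> K" "l \<in> L" for k l
    unfolding e_def using that unique Kc Lc by (auto intro!: the_equality)
  have decomp: "\<exists>k\<in>K. \<exists>l\<in>L. x = k \<oplus>\<^bsub>M\<^esub> l" if "x \<in> carrier M" for x
    using that unfolding sum[symmetric] set_add_def' by auto
  have zeroL: "\<zero>\<^bsub>M\<^esub> \<in> L" using int by auto
  have e_K: "e k = k" if "k \<in> K" for k
    using e_sum[OF that zeroL] Kc[OF that] by simp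
  have e_in: "e x \<in> K" if "x \<in> carrier M" for x
    using decomp[OF that] e_sum by auto
  have "e \<in> mod_hom R M M"
  proof (rule mod_homI)
    fix x y assume "x \<in> carrier M" "y \<in> carrier M"
    then obtain k l k' l' where d: "k \<in> K" "l \<in> L" "x = k \<oplus>\<^bsub>M\<^esub> l" "k' \<in> K" "l' \<in> L" "y = k' \<oplus>\<^bsub>M\<^esub> l'"
      using decomp by metis
    then have "x \<oplus>\<^bsub>M\<^esub> y = (k \<oplus>\<^bsub>M\<^esub> k') \<oplus>\<^bsub>M\<^esub> (l \<oplus>\<^bsub>M\<^esub> l')"
      using Kc Lc by (simp add: M.a_ac)
    then show "e (x \<oplus>\<^bsub>M\<^esub> y) = e x \<oplus>\<^bsub>M\<^esub> e y"
      using d e_sum addK addL by simp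
  next
    fix a x assume a: "a \<in> carrier R" and "x \<in> carrier M"
    then obtain k l where d: "k \<in> K" "l \<in> L" "x = k \<oplus>\<^bsub>M\<^esub> l"
      using decomp by metis
    then have "a \<odot>\<^bsub>M\<^esub> x = a \<odot>\<^bsub>M\<^esub> k \<oplus>\<^bsub>M\<^esub> a \<odot>\<^bsub>M\<^esub> l"
      using a Kc Lc by (simp add: smult_r_distr)
    then show "e (a \<odot>\<^bsub>M\<^esub> x) = a \<odot>\<^bsub>M\<^esub> e x"
      using d a e_sum smultK smultL by simp
  qed (use e_in Kc in \<open>auto simp: e_def\<close>)
  moreover have "compose (carrier M) e e = e"
    using e_in e_K by (auto simp: compose_def e_def fun_eq_iff)
  moreover have "e ` carrier M = K"
    using e_in e_K Kc by force
  ultimately show ?thesis by blast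
qed

lemma idempotent_apply:
  assumes "compose A e e = e"
  shows "x \<in> A \<Longrightarrow> e (e x) = e x"
    and "y \<in> e ` A \<Longrightarrow> e y = y"
  using assms by (metis compose_eq, metis compose_eq imageE)

text \<open>Serves once for each summand of the direct sum: \<open>f\<close> is the component of the
  endomorphism from the summand \<open>M\<close> back into itself, \<open>g\<close> its component
  into the other summand \<open>N\<close>.\<close>

lemma kernel_inter_idempotent:
  assumes "rickart_module R M" and "right_module R N" and "relatively_rickart R M N"
    and f: "f \<in> mod_hom R M M" and g: "g \<in> mod_hom R M N"
  shows "\<exists>h\<in>mod_hom R M M. compose (carrier M) h h = h \<and>
    h ` carrier M = a_kernel M M f \<inter> a_kernel M N g"
proof -
  interpret M: rickart_module R M by fact
  interpret N: right_module R N by fact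
  obtain e where e: "e \<in> mod_hom R M M" "compose (carrier M) e e = e"
    and im_e: "a_kernel M M f = e ` carrier M"
    using M.rickart[of f] f by auto
  have ge: "compose (carrier M) g e \<in> mod_hom R M N"
    using mod_hom_compose[OF M.right_module_axioms e(1) g] .
  then obtain p where p: "p \<in> mod_hom R M M" "compose (carrier M) p p = p"
    and im_p: "p ` carrier M = a_kernel M N (compose (carrier M) g e)"
    using assms(3) M.direct_summand_idempotent unfolding relatively_rickart_def by blast
  have im_p_iff: "x \<in> p ` carrier M \<longleftrightarrow> x \<in> carrier M \<and> g (e x) = \<zero>\<^bsub>N\<^esub>" for x
    unfolding im_p by (auto simp: a_kernel_iff compose_def)
  define h where "h = compose (carrier M) e p"
  have h: "h \<in> mod_hom R M M"
    unfolding h_def using mod_hom_compose[OF M.right_module_axioms p(1) e(1)] .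
  \<comment> \<open>The value e (p x) lies in the image of \<open>e\<close>, which is the kernel of
    \<open>f\<close>; and \<open>g\<close> kills it because p x lies in the kernel of
    \<open>g\<close> after \<open>e\<close>.\<close>
  have h_in: "h x \<in> a_kernel M M f \<inter> a_kernel M N g" if "x \<in> carrier M" for x
  proof -
    have "p x \<in> carrier M" "g (e (p x)) = \<zero>\<^bsub>N\<^esub>" using im_p_iff that by auto
    then show ?thesis
      using that mod_hom_closed[OF e(1)] im_e by (auto simp: h_def compose_eq a_kernel_iff[of _ M N])
  qed
  \<comment> \<open>Being in the kernel of \<open>f\<close>, the element x is fixed by
    \<open>e\<close>. Hence g (e x) = g x = 0, so x is in the image of \<open>p\<close> and is fixed
    by \<open>p\<close> too.\<close>
  have h_fix: "h x = x" if x: "x \<in> a_kernel M M f \<inter> a_kernel M N g" for x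
  proof -
    have "x \<in> carrier M" "g x = \<zero>\<^bsub>N\<^esub>" using x by (auto simp: a_kernel_iff)
    moreover have "e x = x" using x im_e by (intro idempotent_apply(2)[OF e(2)]) blast
    moreover from calculation have "p x = x"
      by (intro idempotent_apply(2)[OF p(2)]) (simp add: im_p_iff)
    ultimately show ?thesis by (simp add: h_def compose_eq)
  qed
  \<comment> \<open>A map of \<open>M\<close> into a subset that it fixes pointwise is idempotent
    with that subset as image. Extensionality settles the equation off the carrier, where both sides
    are \<open>undefined\<close>.\<close>
  have "compose (carrier M) h h = h"
    using h_in h_fix mod_hom_extensional[OF h]
    by (auto simp: compose_def fun_eq_iff extensional_def)
  moreover have "h ` carrier M = a_kernel M M f \<inter> a_kernel M N g"
    using h_in h_fix by (force simp: a_kernel_iff)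
  ultimately show ?thesis using h by blast
qed

theorem theorem2p5:
  fixes R :: "('a, 'r) ring_scheme"
    and M1 :: "('a, 'b, 'm) module_scheme"
    and M2 :: "('a, 'c, 'n) module_scheme"
  assumes "rickart_module R M1" and "rickart_module R M2"
    and "\<And>N. submodule N R (mod_dsum M1 M2) \<Longrightarrow>
      \<exists>N1 N2. submodule N1 R M1 \<and> submodule N2 R M2 \<and> N = N1 \<times> N2"
    and "relatively_rickart R M1 M1" and "relatively_rickart R M1 M2"
    and "relatively_rickart R M2 M1" and "relatively_rickart R M2 M2"
  shows "rickart_module R (mod_dsum M1 M2)"
proof -
  interpret M1: rickart_module R M1 by fact
  interpret M2: rickart_module R M2 by fact
  let ?M = "mod_dsum M1 M2"
  note r1 = M1.right_module_axioms and r2 = M2.right_module_axioms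
  have rM: "right_module R ?M" using right_module_mod_dsum[OF r1 r2] .
  show ?thesis
  proof (rule rickart_module.intro[OF rM], rule rickart_module_axioms.intro)
    fix \<phi> assume "\<phi> \<in> carrier (mod_End R ?M)"
    then have \<phi>: "\<phi> \<in> mod_hom R ?M ?M" by simp
    \<comment> \<open>Inclusions and projections of the direct sum; composing \<phi> with them
      yields its four matrix entries.\<close>
    define i1 where "i1 = (\<lambda>x\<in>carrier M1. (x, \<zero>\<^bsub>M2\<^esub>))"
    define i2 where "i2 = (\<lambda>y\<in>carrier M2. (\<zero>\<^bsub>M1\<^esub>, y))"
    define p1 where "p1 = (\<lambda>z\<in>carrier ?M. fst z)"
    define p2 where "p2 = (\<lambda>z\<in>carrier ?M. snd z)"
    have i1: "i1 \<in> mod_hom R M1 ?M" and i2: "i2 \<in> mod_hom R M2 ?M"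
      by (auto intro!: mod_homI simp: i1_def i2_def)
    have p1: "p1 \<in> mod_hom R ?M M1" and p2: "p2 \<in> mod_hom R ?M M2"
      by (auto intro!: mod_homI simp: p1_def p2_def)
    let ?f1 = "compose (carrier M1) \<phi> i1" and ?f2 = "compose (carrier M2) \<phi> i2"
    note f1 = mod_hom_compose[OF r1 i1 \<phi>] and f2 = mod_hom_compose[OF r2 i2 \<phi>]
    obtain h1 where h1: "h1 \<in> mod_hom R M1 M1" "compose (carrier M1) h1 h1 = h1"
      and im1: "h1 ` carrier M1 = a_kernel M1 M1 (compose (carrier M1) p1 ?f1) \<inter>
        a_kernel M1 M2 (compose (carrier M1) p2 ?f1)"
      using kernel_inter_idempotent[OF assms(1) r2 assms(5)
        mod_hom_compose[OF r1 f1 p1] mod_hom_compose[OF r1 f1 p2]] by blast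
    \<comment> \<open>The entries appear in the opposite order to those for \<open>h1\<close>, since
      the endomorphism of \<open>M2\<close> among them is the one through \<open>p2\<close>.\<close>
    obtain h2 where h2: "h2 \<in> mod_hom R M2 M2" "compose (carrier M2) h2 h2 = h2"
      and im2: "h2 ` carrier M2 = a_kernel M2 M2 (compose (carrier M2) p2 ?f2) \<inter>
        a_kernel M2 M1 (compose (carrier M2) p1 ?f2)"
      using kernel_inter_idempotent[OF assms(2) r1 assms(6)
        mod_hom_compose[OF r2 f2 p2] mod_hom_compose[OF r2 f2 p1]] by blast
    have zero_iff: "z = \<zero>\<^bsub>?M\<^esub> \<longleftrightarrow> p1 z = \<zero>\<^bsub>M1\<^esub> \<and> p2 z = \<zero>\<^bsub>M2\<^esub>" if "z \<in> carrier ?M" for z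
      using that by (auto simp: p1_def p2_def)
    \<comment> \<open>Since (x, 0) is \<open>i1 x\<close>, it is killed by \<phi> exactly when x is
      killed by both entries starting at \<open>M1\<close>.\<close>
    have im1_iff: "x \<in> h1 ` carrier M1 \<longleftrightarrow> (x, \<zero>\<^bsub>M2\<^esub>) \<in> a_kernel ?M ?M \<phi>" for x
      using zero_iff[OF mod_hom_closed[OF \<phi>, of "(x, \<zero>\<^bsub>M2\<^esub>)"]]
      by (auto simp: im1 a_kernel_iff compose_def i1_def)
    have im2_iff: "y \<in> h2 ` carrier M2 \<longleftrightarrow> (\<zero>\<^bsub>M1\<^esub>, y) \<in> a_kernel ?M ?M \<phi>" for y
      using zero_iff[OF mod_hom_closed[OF \<phi>, of "(\<zero>\<^bsub>M1\<^esub>, y)"]]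
      by (auto simp: im2 a_kernel_iff compose_def i2_def)
    have "submodule (a_kernel ?M ?M \<phi>) R ?M" using submodule_a_kernel[OF rM rM \<phi>] .
    then obtain N1 N2 where N: "submodule N1 R M1" "submodule N2 R M2"
      and ker: "a_kernel ?M ?M \<phi> = N1 \<times> N2"
      using assms(3) by metis
    \<comment> \<open>The zeros allow each factor to be read off the product: x is in
      \<open>N1\<close> iff (x, 0) is in the kernel, and likewise for \<open>N2\<close>.\<close>
    have "\<zero>\<^bsub>M1\<^esub> \<in> N1" "\<zero>\<^bsub>M2\<^esub> \<in> N2"
      using subgroup.one_closed[OF submodule.axioms(1)[OF N(1)]]
        subgroup.one_closed[OF submodule.axioms(1)[OF N(2)]] by auto
    then have im: "h1 ` carrier M1 = N1" "h2 ` carrier M2 = N2"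
      using im1_iff im2_iff ker by auto
    \<comment> \<open>The diagonal map with entries \<open>h1\<close> and \<open>h2\<close>: it
      inherits idempotence from them, and its image is the product of their images.\<close>
    define e where "e = (\<lambda>z\<in>carrier ?M. (h1 (fst z), h2 (snd z)))"
    have "e \<in> mod_hom R ?M ?M"
      by (rule mod_homI) (auto simp: e_def mod_homD[OF h1(1)] mod_homD[OF h2(1)])
    moreover have "compose (carrier ?M) e e = e"
      using idempotent_apply(1)[OF h1(2)] idempotent_apply(1)[OF h2(2)]
        mod_hom_closed[OF h1(1)] mod_hom_closed[OF h2(1)]
      by (auto simp: compose_def e_def fun_eq_iff)
    moreover have "e ` carrier ?M = N1 \<times> N2"
      unfolding im[symmetric] by (force simp: e_def)
    ultimately show "\<exists>e\<in>carrier (mod_End R ?M).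
        e \<otimes>\<^bsub>mod_End R ?M\<^esub> e = e \<and> a_kernel ?M ?M \<phi> = e ` carrier ?M"
      using ker by auto
  qed
qed

end
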